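(* Let $\delta,\nu\ge 0$ and let $X$ be a finite nonempty metric space that is $\delta$-hyperbolic and $\nu$-geodesic. Then there exists a discrete gradient on the full simplicial complex $\operatorname{Cl}(X)$ that induces, for every $u>t\geq 4\delta+2\nu$, a sequence of collapses $$\operatorname{Rips}_u(X)\searrow \operatorname{Rips}_t(X)\searrow \{*\},$$ where $\{*\}$ denotes a subcomplex consisting of a single vertex.
   Context: A metric space $(X,d)$ is $\delta$-hyperbolic if for all $w,x,y,z\in X$: $d(w,x)+d(y,z)\leq \max\{d(w,y)+d(x,z),\,d(w,z)+d(x,y)\}+2\delta$. It is $\nu$-geodesic if for all $x,y\in X$ and $r,s\geq 0$ with $r+s=d(x,y)$ there exists $z\in X$ with $d(x,z)\leq r+\nu$ and $d(y,z)\leq s+\nu$. For $t\ge 0$, $\operatorname{Rips}_t(X)=\{\emptyset\neq S\subseteq X\mid S\text{ finite},\ \operatorname{diam}S\leq t\}$. $\operatorname{Cl}(X)$ is the full simplicial complex of all nonempty subsets of the finite set $X$. Simplicial complexes consist of nonempty finite sets and are closed under taking nonempty subsets. For a simplicial complex $K$ and simplices $\rho\subseteq\phi$ put $[\rho,\phi]=\{\psi\in K\mid \rho\subseteq\psi\subseteq\phi\}$. A function $f\colon K\to\mathbb R$ is a discrete Morse function if it is monotonic ($\sigma\subseteq\tau$ implies $f(\sigma)\le f(\tau)$) and there is a partition of $K$ into intervals such that for any $\sigma\subseteq\tau$ one has $f(\sigma)=f(\tau)$ if and only if $\sigma$ and $\tau$ belong to a common interval of the partition. The collection of the regular intervals,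 i.e. those with $\rho\ne\phi$, is the discrete gradient of $f$; a discrete gradient on $K$ is a collection of intervals arising this way. An elementary collapse $K\searrow K\setminus\{\sigma,\tau\}$ removes a pair of simplices where $\sigma$ is a facet of $\tau$ and $\tau$ is the unique proper coface of $\sigma$; a collapse $K\searrow L$ onto a subcomplex $L$ is a finite sequence of elementary collapses from $K$ to $L$. A discrete gradient $W$ on a finite complex $M$ induces a collapse $K\searrow L$ between subcomplexes $L\subseteq K\subseteq M$ if $K\setminus L$ is a union of (regular) intervals of $W$ and $K$ collapses to $L$. *)

theory Defs
  imports "HOL-Analysis.Analysis" "HOL-Library.Disjoint_Sets"
begin

text \<open>
  The metric notions below refer to a carrier set together with a distance function, as in the locale
  \<^locale>\<open>Metric_space\<close>; the distance is only used on the carrier.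
\<close>

definition gromov_hyperbolic :: "real \<Rightarrow> 'a set \<Rightarrow> ('a \<Rightarrow> 'a \<Rightarrow> real) \<Rightarrow> bool" where
  "gromov_hyperbolic \<delta> X d \<longleftrightarrow>
     (\<forall>w\<in>X. \<forall>x\<in>X. \<forall>y\<in>X. \<forall>z\<in>X.
        d w x + d y z \<le> max (d w y + d x z) (d w z + d x y) + 2 * \<delta>)"

definition nu_geodesic :: "real \<Rightarrow> 'a set \<Rightarrow> ('a \<Rightarrow> 'a \<Rightarrow> real) \<Rightarrow> bool" where
  "nu_geodesic \<nu> X d \<longleftrightarrow>
     (\<forall>x\<in>X. \<forall>y\<in>X. \<forall>r s. 0 \<le> r \<and> 0 \<le> s \<and> r + s = d x y \<longrightarrow>
        (\<exists>z\<in>X. d x z \<le> r + \<nu> \<and> d y z \<le> s + \<nu>))"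

text \<open>Only meaningful for nonempty sets on which the distance is bounded.\<close>

definition diam :: "('a \<Rightarrow> 'a \<Rightarrow> real) \<Rightarrow> 'a set \<Rightarrow> real" where
  "diam d S = (SUP (x, y) \<in> S \<times> S. d x y)"

definition abstract_complex :: "'a set set \<Rightarrow> bool" where
  "abstract_complex K \<longleftrightarrow>
     (\<forall>\<sigma>\<in>K. finite \<sigma> \<and> \<sigma> \<noteq> {} \<and> (\<forall>\<rho>. \<rho> \<noteq> {} \<and> \<rho> \<subseteq> \<sigma> \<longrightarrow> \<rho> \<in> K))"

definition subcomplex :: "'a set set \<Rightarrow> 'a set set \<Rightarrow> bool" where
  "subcomplex L K \<longleftrightarrow> abstract_complex L \<and> abstract_complex K \<and> L \<subseteq> K"

definition Rips :: "'a set \<Rightarrow> ('a \<Rightarrow> 'a \<Rightarrow> real) \<Rightarrow> real \<Rightarrow> 'a set set" where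
  "Rips X d t = {S. S \<noteq> {} \<and> S \<subseteq> X \<and> finite S \<and> diam d S \<le> t}"

definition Cl :: "'a set \<Rightarrow> 'a set set" where
  "Cl X = {S. S \<noteq> {} \<and> S \<subseteq> X \<and> finite S}"

definition face_interval :: "'a set set \<Rightarrow> 'a set \<Rightarrow> 'a set \<Rightarrow> 'a set set" where
  "face_interval K \<rho> \<phi> = {\<psi>\<in>K. \<rho> \<subseteq> \<psi> \<and> \<psi> \<subseteq> \<phi>}"

definition is_interval_in :: "'a set set \<Rightarrow> 'a set set \<Rightarrow> bool" where
  "is_interval_in K I \<longleftrightarrow>
     (\<exists>\<rho>\<in>K. \<exists>\<phi>\<in>K. \<rho> \<subseteq> \<phi> \<and> I = face_interval K \<rho> \<phi>)"

definition is_regular_interval_in :: "'a set set \<Rightarrow> 'a set set \<Rightarrow> bool" where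
  "is_regular_interval_in K I \<longleftrightarrow>
     (\<exists>\<rho>\<in>K. \<exists>\<phi>\<in>K. \<rho> \<subseteq> \<phi> \<and> \<rho> \<noteq> \<phi> \<and> I = face_interval K \<rho> \<phi>)"

definition monotonic_on_complex :: "'a set set \<Rightarrow> ('a set \<Rightarrow> real) \<Rightarrow> bool" where
  "monotonic_on_complex K f \<longleftrightarrow> (\<forall>\<sigma>\<in>K. \<forall>\<tau>\<in>K. \<sigma> \<subseteq> \<tau> \<longrightarrow> f \<sigma> \<le> f \<tau>)"

definition morse_partition :: "'a set set \<Rightarrow> ('a set \<Rightarrow> real) \<Rightarrow> 'a set set set \<Rightarrow> bool" where
  "morse_partition K f P \<longleftrightarrow>
     partition_on K P \<and> (\<forall>I\<in>P. is_interval_in K I) \<and>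
     (\<forall>\<sigma>\<in>K. \<forall>\<tau>\<in>K. \<sigma> \<subseteq> \<tau> \<longrightarrow> (f \<sigma> = f \<tau> \<longleftrightarrow> (\<exists>I\<in>P. \<sigma> \<in> I \<and> \<tau> \<in> I)))"

definition discrete_Morse_function :: "'a set set \<Rightarrow> ('a set \<Rightarrow> real) \<Rightarrow> bool" where
  "discrete_Morse_function K f \<longleftrightarrow>
     monotonic_on_complex K f \<and> (\<exists>P. morse_partition K f P)"

text \<open>
  The partition \<open>P\<close> is determined by \<open>f\<close>: its blocks are the classes of the equivalence
  relation generated by comparable simplices with equal value. So the following relation
  determines \<open>W\<close> uniquely from \<open>f\<close>.
\<close>

definition gradient_of :: "'a set set \<Rightarrow> ('a set \<Rightarrow> real) \<Rightarrow> 'a set set set \<Rightarrow> bool" where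
  "gradient_of K f W \<longleftrightarrow>
     (\<exists>P. morse_partition K f P \<and> W = {I\<in>P. is_regular_interval_in K I})"

definition discrete_gradient :: "'a set set \<Rightarrow> 'a set set set \<Rightarrow> bool" where
  "discrete_gradient K W \<longleftrightarrow>
     (\<exists>f. discrete_Morse_function K f \<and> gradient_of K f W)"

definition facet_of_simplex :: "'a set \<Rightarrow> 'a set \<Rightarrow> bool" where
  "facet_of_simplex \<sigma> \<tau> \<longleftrightarrow> \<sigma> \<subseteq> \<tau> \<and> card \<tau> = card \<sigma> + 1"

definition elementary_collapse :: "'a set set \<Rightarrow> 'a set set \<Rightarrow> bool" where
  "elementary_collapse K L \<longleftrightarrow>
     abstract_complex K \<and>
     (\<exists>\<sigma>\<in>K. \<exists>\<tau>\<in>K. facet_of_simplex \<sigma> \<tau> \<and> {\<psi>\<in>K. \<sigma> \<subset> \<psi>} = {\<tau>} \<and> L = K - {\<sigma>, \<tau>})"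

text \<open>The sequence of elementary collapses may be empty.\<close>

definition collapses :: "'a set set \<Rightarrow> 'a set set \<Rightarrow> bool" where
  "collapses K L \<longleftrightarrow> subcomplex L K \<and> elementary_collapse\<^sup>*\<^sup>* K L"

definition induces_collapse ::
    "'a set set \<Rightarrow> 'a set set set \<Rightarrow> 'a set set \<Rightarrow> 'a set set \<Rightarrow> bool" where
  "induces_collapse M W K L \<longleftrightarrow>
     finite M \<and> discrete_gradient M W \<and> subcomplex K M \<and> subcomplex L K \<and>
     (\<exists>V\<subseteq>W. K - L = \<Union>V) \<and> collapses K L"

end

theory Submission
  imports Defs
begin

text \<open>
  Put \<open>s = 4 * \<delta> + 2 * \<nu>\<close>. Every simplex other than one chosen vertex \<open>{p}\<close> is
  matched with the simplex obtained by inserting or deleting one further vertex, its apex; the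
  matching is a gradient because the apex depends only on a natural number, the level, that is
  monotone on simplices and is not changed by inserting or deleting the apex.

  Long simplices, of diameter above \<open>s\<close>. Rank all pairs of points by distance, breaking ties
  arbitrarily, and let \<open>(x, y)\<close> be the highest pair of the simplex. The geodesic defect provides
  an approximate midpoint \<open>z\<close> of \<open>x\<close> and \<open>y\<close>. If \<open>w\<close> has distance at
  most \<open>d x y\<close> from both \<open>x\<close> and \<open>y\<close>, then hyperbolicity applied to \<open>w, z, x, y\<close>
  gives \<open>d w z \<le> d x y / 2 + \<nu> + 2 * \<delta>\<close>, which is less than \<open>d x y\<close> precisely because
  \<open>d x y > s\<close> (lemma \<open>midpoint_apex\<close>). So \<open>z\<close> is neither \<open>x\<close> nor
  \<open>y\<close> and takes part in no edge as long as \<open>d x y\<close>: inserting or deleting it keeps the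
  highest pair, and with it the diameter.

  Short simplices, of diameter at most \<open>s\<close>. Rank the points by their distance from \<open>p\<close> and let
  \<open>x\<close> be the highest vertex of the simplex. If \<open>x \<noteq> p\<close>, a point \<open>z\<close> strictly
  closer to \<open>p\<close>, namely \<open>p\<close> itself or an approximate point at distance about \<open>s / 2\<close>
  from \<open>x\<close> on the way to \<open>p\<close>, is within \<open>s\<close> of every vertex of the simplex (lemma \<open>apex_towards_basepoint\<close>).
  Inserting or deleting it keeps the simplex short and its highest vertex equal to \<open>x\<close>.

  Only \<open>{p}\<close> stays unmatched. For \<open>t \<ge> s\<close> a simplex has diameter at most \<open>t\<close> if and only
  if its partner has, so \<open>Rips X d u - Rips X d t\<close> and \<open>Rips X d t - {{p}}\<close> are unions of
  matched pairs, and a union of matched pairs between two subcomplexes can be collapsed away in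
  order of decreasing Morse value (lemma \<open>elementary_collapses_blocks\<close>).
\<close>

section \<open>Coning off the levels of a monotone function\<close>

locale level_cones =
  fixes M :: "'a set set" and g :: "'a set \<Rightarrow> nat" and apex :: "nat \<Rightarrow> 'a"
  assumes finite_M: "finite M"
    and complex_M: "abstract_complex M"
    and level_mono: "\<lbrakk>\<sigma> \<in> M; \<tau> \<in> M; \<sigma> \<subseteq> \<tau>\<rbrakk> \<Longrightarrow> g \<sigma> \<le> g \<tau>"
begin

text \<open>
  On a regular level every simplex can be coned off with the apex of the level, so the level
  decomposes into pairs that differ in the apex only.
\<close>

definition regular_level :: "nat \<Rightarrow> bool" where
  "regular_level n \<longleftrightarrow>
     (\<forall>\<sigma>\<in>M. g \<sigma> = n \<longrightarrow>
        insert (apex n) \<sigma> \<in> M \<and> g (insert (apex n) \<sigma>) = n \<and>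
        \<sigma> - {apex n} \<in> M \<and> g (\<sigma> - {apex n}) = n)"

text \<open>
  A common description of both kinds of blocks: on a regular level the pair of simplices that
  differ from \<open>\<sigma>\<close> at most in the apex, and a singleton on a level with just one simplex.
\<close>

definition block :: "'a set \<Rightarrow> 'a set set" where
  "block \<sigma> = {\<tau>\<in>M. g \<tau> = g \<sigma> \<and> insert (apex (g \<sigma>)) \<tau> = insert (apex (g \<sigma>)) \<sigma>}"

text \<open>
  The lexicographic order of the level and the size after insertion of the apex, encoded as a
  single number: the size is at most \<open>card (\<Union>M) + 1\<close>, as the apex need not be a vertex of
  \<open>M\<close>.
\<close>

definition morse_value :: "'a set \<Rightarrow> real" where
  "morse_value \<sigma> =
     real (g \<sigma> * (card (\<Union>M) + 2) + card (insert (apex (g \<sigma>)) \<sigma>))"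

lemma face_closed:
  assumes "abstract_complex L" "\<tau> \<in> L" "\<rho> \<in> M" "\<rho> \<subseteq> \<tau>"
  shows "\<rho> \<in> L"
proof -
  have "\<rho> \<noteq> {}"
    using complex_M assms(3) by (auto simp: abstract_complex_def)
  moreover have "\<forall>\<rho>. \<rho> \<noteq> {} \<and> \<rho> \<subseteq> \<tau> \<longrightarrow> \<rho> \<in> L"
    using assms(1,2) unfolding abstract_complex_def by (elim ballE[where x = \<tau>]) simp_all
  ultimately show ?thesis
    using assms(4) by simp
qed

lemma finite_simplex: "\<sigma> \<in> M \<Longrightarrow> finite \<sigma>"
  using complex_M by (auto simp: abstract_complex_def)

lemma block_self: "\<sigma> \<in> M \<Longrightarrow> \<sigma> \<in> block \<sigma>"
  by (simp add: block_def)

lemma block_subset: "block \<sigma> \<subseteq> M"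
  by (auto simp: block_def)

lemma block_eq: "\<tau> \<in> block \<sigma> \<Longrightarrow> block \<tau> = block \<sigma>"
  by (auto simp: block_def)

lemma block_regular:
  assumes "\<sigma> \<in> M" "regular_level (g \<sigma>)"
  shows "block \<sigma> = {\<sigma> - {apex (g \<sigma>)}, insert (apex (g \<sigma>)) \<sigma>}"
    and "\<sigma> - {apex (g \<sigma>)} \<in> M" and "insert (apex (g \<sigma>)) \<sigma> \<in> M"
proof -
  have *: "insert (apex (g \<sigma>)) \<sigma> \<in> M" "g (insert (apex (g \<sigma>)) \<sigma>) = g \<sigma>"
     "\<sigma> - {apex (g \<sigma>)} \<in> M" "g (\<sigma> - {apex (g \<sigma>)}) = g \<sigma>"
    using assms unfolding regular_level_def by blast+
  have "\<tau> = \<sigma> - {z} \<or> \<tau> = insert z \<sigma>" if "insert z \<tau> = insert z \<sigma>" for \<tau> z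
    using that by (cases "z \<in> \<tau>") auto
  with * show "block \<sigma> = {\<sigma> - {apex (g \<sigma>)}, insert (apex (g \<sigma>)) \<sigma>}"
    by (auto simp: block_def)
  show "\<sigma> - {apex (g \<sigma>)} \<in> M" "insert (apex (g \<sigma>)) \<sigma> \<in> M"
    using * by simp_all
qed

lemma block_regular_interval:
  assumes "\<sigma> \<in> M" "regular_level (g \<sigma>)"
  shows "is_regular_interval_in M (block \<sigma>)"
proof -
  let ?z = "apex (g \<sigma>)"
  note b = block_regular[OF assms]
  have "\<psi> = \<sigma> - {?z} \<or> \<psi> = insert ?z \<sigma>" if "\<sigma> - {?z} \<subseteq> \<psi>" "\<psi> \<subseteq> insert ?z \<sigma>" for \<psi>
    using that by (cases "?z \<in> \<psi>") auto
  then have "block \<sigma> = face_interval M (\<sigma> - {?z}) (insert ?z \<sigma>)"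
    using b by (auto simp: face_interval_def)
  moreover have "\<sigma> - {?z} \<subseteq> insert ?z \<sigma>" "\<sigma> - {?z} \<noteq> insert ?z \<sigma>"
    by auto
  ultimately show ?thesis
    using b unfolding is_regular_interval_in_def by blast
qed

lemma morse_value_less:
  assumes "\<sigma> \<in> M" "g \<sigma> < g \<tau>"
  shows "morse_value \<sigma> < morse_value \<tau>"
proof -
  have fin: "finite (\<Union>M)"
    using finite_M finite_simplex by blast
  have "card (insert (apex (g \<sigma>)) \<sigma>) \<le> Suc (card \<sigma>)"
    by (simp add: card_insert_le_m1)
  also have "card \<sigma> \<le> card (\<Union>M)"
    using fin assms(1) by (intro card_mono) auto
  finally have "card (insert (apex (g \<sigma>)) \<sigma>) < card (\<Union>M) + 2"
    by simp
  then have "g \<sigma> * (card (\<Union>M) + 2) + card (insert (apex (g \<sigma>)) \<sigma>)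
      < Suc (g \<sigma>) * (card (\<Union>M) + 2)"
    by simp
  also have "\<dots> \<le> g \<tau> * (card (\<Union>M) + 2)"
    using assms(2) by (intro mult_le_mono1) simp
  finally show ?thesis
    unfolding morse_value_def of_nat_less_iff by simp
qed

text \<open>
  Within a level, \<open>\<sigma> \<subseteq> \<tau>\<close> persists after insertion of the common apex, so equal sizes
  mean that \<open>\<sigma>\<close> and \<open>\<tau>\<close> agree up to the apex.
\<close>

lemma morse_value_mono:
  assumes "\<sigma> \<in> M" "\<tau> \<in> M" "\<sigma> \<subseteq> \<tau>"
  shows "morse_value \<sigma> \<le> morse_value \<tau>"
    and "morse_value \<sigma> = morse_value \<tau> \<longleftrightarrow> \<tau> \<in> block \<sigma>"
proof -
  let ?z = "apex (g \<sigma>)"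
  have "morse_value \<sigma> \<le> morse_value \<tau> \<and> (morse_value \<sigma> = morse_value \<tau> \<longleftrightarrow> \<tau> \<in> block \<sigma>)"
  proof (cases "g \<sigma> = g \<tau>")
    case True
    have fin: "finite (insert ?z \<tau>)" and sub: "insert ?z \<sigma> \<subseteq> insert ?z \<tau>"
      using finite_simplex assms by auto
    have "card (insert ?z \<sigma>) \<le> card (insert ?z \<tau>)"
      using fin sub by (rule card_mono)
    moreover have "card (insert ?z \<sigma>) = card (insert ?z \<tau>) \<longleftrightarrow> insert ?z \<sigma> = insert ?z \<tau>"
      using card_subset_eq[OF fin sub] by metis
    ultimately show ?thesis
      using True assms(2) by (auto simp: morse_value_def block_def)
  next
    case False
    then have "g \<sigma> < g \<tau>"
      using level_mono[OF assms] by simp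
    then show ?thesis
      using morse_value_less[OF assms(1) \<open>g \<sigma> < g \<tau>\<close>] False by (auto simp: block_def)
  qed
  then show "morse_value \<sigma> \<le> morse_value \<tau>"
    and "morse_value \<sigma> = morse_value \<tau> \<longleftrightarrow> \<tau> \<in> block \<sigma>"
    by blast+
qed

definition gradient :: "'a set set set" where
  "gradient = {I \<in> block ` M. is_regular_interval_in M I}"

lemma discrete_gradient_gradient:
  assumes levels: "\<And>\<sigma>. \<sigma> \<in> M \<Longrightarrow> regular_level (g \<sigma>) \<or> (\<forall>\<tau>\<in>M. g \<tau> = g \<sigma> \<longrightarrow> \<tau> = \<sigma>)"
  shows "discrete_gradient M gradient"
proof -
  have interval: "is_interval_in M (block \<sigma>)" if "\<sigma> \<in> M" for \<sigma>
    using levels[OF that]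
  proof
    assume "regular_level (g \<sigma>)"
    then show ?thesis
      using block_regular_interval[OF that]
      by (auto simp: is_interval_in_def is_regular_interval_in_def)
  next
    assume "\<forall>\<tau>\<in>M. g \<tau> = g \<sigma> \<longrightarrow> \<tau> = \<sigma>"
    then have "block \<sigma> = face_interval M \<sigma> \<sigma>"
      using that by (auto simp: block_def face_interval_def)
    then show ?thesis
      using that by (auto simp: is_interval_in_def)
  qed
  have "partition_on M (block ` M)"
  proof (rule partition_onI)
    show "\<Union> (block ` M) = M"
      using block_self block_subset by blast
    show "disjnt p q" if "p \<in> block ` M" "q \<in> block ` M" "p \<noteq> q" for p q
    proof -
      obtain \<sigma> \<tau> where "p = block \<sigma>" "q = block \<tau>"
        using \<open>p \<in> block ` M\<close> \<open>q \<in> block ` M\<close> by blast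
      then show ?thesis
        using \<open>p \<noteq> q\<close> block_eq[of _ \<sigma>] block_eq[of _ \<tau>] unfolding disjnt_iff by metis
    qed
    show "{} \<notin> block ` M"
      using block_self by blast
  qed
  moreover have "morse_value \<sigma> = morse_value \<tau> \<longleftrightarrow> (\<exists>I\<in>block ` M. \<sigma> \<in> I \<and> \<tau> \<in> I)"
    if "\<sigma> \<in> M" "\<tau> \<in> M" "\<sigma> \<subseteq> \<tau>" for \<sigma> \<tau>
  proof
    assume "morse_value \<sigma> = morse_value \<tau>"
    then show "\<exists>I\<in>block ` M. \<sigma> \<in> I \<and> \<tau> \<in> I"
      using morse_value_mono(2)[OF that] that(1) block_self by blast
  next
    assume "\<exists>I\<in>block ` M. \<sigma> \<in> I \<and> \<tau> \<in> I"
    then have "\<tau> \<in> block \<sigma>"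
      using block_eq by blast
    then show "morse_value \<sigma> = morse_value \<tau>"
      using morse_value_mono(2)[OF that] by simp
  qed
  ultimately have "morse_partition M morse_value (block ` M)"
    using interval by (auto simp: morse_partition_def)
  then show ?thesis
    unfolding discrete_gradient_def discrete_Morse_function_def gradient_of_def
      monotonic_on_complex_def gradient_def
    using morse_value_mono(1) by blast
qed

text \<open>
  A simplex of maximal Morse value outside \<open>L\<close> lies in a collapsible pair: a proper coface of
  the smaller member of the pair is again outside \<open>L\<close>, so by maximality it has the same Morse
  value and belongs to the pair.
\<close>

lemma elementary_collapse_block:
  assumes K: "abstract_complex K" "K \<subseteq> M" and L: "abstract_complex L"
    and \<sigma>: "\<sigma> \<in> K - L" "regular_level (g \<sigma>)" "block \<sigma> \<subseteq> K - L"
    and max: "\<And>\<tau>. \<tau> \<in> K - L \<Longrightarrow> morse_value \<tau> \<le> morse_value \<sigma>"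
  shows "elementary_collapse K (K - block \<sigma>)"
proof -
  define \<rho> \<phi> where "\<rho> = \<sigma> - {apex (g \<sigma>)}" and "\<phi> = insert (apex (g \<sigma>)) \<sigma>"
  have "\<sigma> \<in> M"
    using \<sigma>(1) K(2) by blast
  note b = block_regular[OF this \<sigma>(2), folded \<rho>_def \<phi>_def]
  have mem: "\<rho> \<in> K - L" "\<phi> \<in> K - L"
    using \<sigma>(3) b(1) by auto
  have \<rho>\<phi>: "\<phi> = insert (apex (g \<sigma>)) \<rho>" "apex (g \<sigma>) \<notin> \<rho>"
    by (auto simp: \<rho>_def \<phi>_def)
  have "\<rho> \<in> block \<sigma>"
    using b(1) by simp
  then have block_\<rho>: "block \<rho> = {\<rho>, \<phi>}"
    using block_eq[of \<rho> \<sigma>] b(1) by blast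
  have "\<psi> = \<phi>" if "\<psi> \<in> K" "\<rho> \<subset> \<psi>" for \<psi>
  proof -
    have "\<psi> \<notin> L"
      \<comment> \<open>otherwise its face \<open>\<rho>\<close> would lie in \<open>L\<close>\<close>
      using face_closed[OF L _ b(2)] that(2) mem(1) by blast
    then have "morse_value \<psi> \<le> morse_value \<sigma>"
      using max that by blast
    also have "morse_value \<sigma> = morse_value \<rho>"
    proof -
      have "\<sigma> \<in> block \<rho>"
        using block_self[OF \<open>\<sigma> \<in> M\<close>] block_\<rho> b(1) by simp
      then show ?thesis
        using morse_value_mono(2)[OF b(2) \<open>\<sigma> \<in> M\<close>] \<rho>_def by auto
    qed
    finally have "morse_value \<rho> = morse_value \<psi>"
      using morse_value_mono(1)[of \<rho> \<psi>] b(2) K(2) that by auto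
    then have "\<psi> \<in> block \<rho>"
      using morse_value_mono(2)[of \<rho> \<psi>] b(2) K(2) that by auto
    then show ?thesis
      using block_\<rho> that by auto
  qed
  then have "{\<psi>\<in>K. \<rho> \<subset> \<psi>} = {\<phi>}"
    using mem \<rho>\<phi> by auto
  moreover have "facet_of_simplex \<rho> \<phi>"
    using finite_simplex[OF b(2)] \<rho>\<phi> by (auto simp: facet_of_simplex_def)
  ultimately show ?thesis
    unfolding elementary_collapse_def using K(1) mem b(1) by blast
qed

text \<open>
  Repeatedly removing the block of highest Morse value. What remains is a complex, since a coface
  of a removed simplex would have to have the maximal Morse value and hence be in the same block.
\<close>

lemma elementary_collapses_blocks:
  assumes K: "abstract_complex K" "K \<subseteq> M" and L: "abstract_complex L" "L \<subseteq> K"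
    and reg: "\<And>\<sigma>. \<sigma> \<in> K - L \<Longrightarrow> regular_level (g \<sigma>)"
    and closed: "\<And>\<sigma>. \<sigma> \<in> K - L \<Longrightarrow> block \<sigma> \<subseteq> K - L"
  shows "elementary_collapse\<^sup>*\<^sup>* K L"
  using K L(2) reg closed
proof (induction "card (K - L)" arbitrary: K rule: less_induct)
  case less
  have fin: "finite (K - L)"
    using finite_subset[OF less.prems(2) finite_M] by simp
  show ?case
  proof (cases "K = L")
    case True
    then show ?thesis by simp
  next
    case False
    then have "K - L \<noteq> {}"
      using less.prems(3) by blast
    then have "Max (morse_value ` (K - L)) \<in> morse_value ` (K - L)"
      using fin by (intro Max_in) auto
    then obtain \<sigma> where \<sigma>: "\<sigma> \<in> K - L"
      and eq: "Max (morse_value ` (K - L)) = morse_value \<sigma>"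
      by blast
    have max: "morse_value \<tau> \<le> morse_value \<sigma>" if "\<tau> \<in> K - L" for \<tau>
      unfolding eq[symmetric] using fin that by (intro Max_ge) auto
    let ?K = "K - block \<sigma>"
    have \<sigma>M: "\<sigma> \<in> M"
      using \<sigma> less.prems(2) by blast
    have step: "elementary_collapse K ?K"
      using less.prems(4,5)[OF \<sigma>] max
      by (rule elementary_collapse_block[OF less.prems(1,2) L(1) \<sigma>])
    have sub: "L \<subseteq> ?K"
      using less.prems(3) less.prems(5)[OF \<sigma>] by blast
    have diff: "?K - L \<subseteq> K - L" "\<sigma> \<in> K - L" "\<sigma> \<notin> ?K - L"
      using \<sigma> block_self[OF \<sigma>M] by auto
    have "elementary_collapse\<^sup>*\<^sup>* ?K L"
    proof (rule less.hyps)
      show "card (?K - L) < card (K - L)"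
        using diff fin by (intro psubset_card_mono) auto
      show "abstract_complex ?K"
        unfolding abstract_complex_def
      proof (intro ballI conjI allI impI)
        fix \<tau> assume \<tau>: "\<tau> \<in> ?K"
        then show "finite \<tau>" "\<tau> \<noteq> {}"
          using less.prems(1) by (auto simp: abstract_complex_def)
        fix \<rho> assume \<rho>: "\<rho> \<noteq> {} \<and> \<rho> \<subseteq> \<tau>"
        then have \<rho>K: "\<rho> \<in> K"
          using \<tau> less.prems(1) by (auto simp: abstract_complex_def)
        have "\<rho> \<notin> block \<sigma>"
        proof
          assume \<rho>b: "\<rho> \<in> block \<sigma>"
          have "\<tau> \<notin> L"
            using face_closed[OF L(1), of \<tau> \<rho>] \<rho> less.prems(2) less.prems(5)[OF \<sigma>] \<rho>b \<rho>K by blast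
          then have le: "morse_value \<tau> \<le> morse_value \<sigma>"
            using \<tau> max by blast
          have "morse_value \<sigma> = morse_value \<rho>"
            using \<rho>b by (auto simp: block_def morse_value_def)
          then have "\<tau> \<in> block \<rho>"
            using morse_value_mono[of \<rho> \<tau>] le \<rho> \<tau> \<rho>K less.prems(2) by force
          then show False
            using block_eq[OF \<rho>b] \<tau> by blast
        qed
        then show "\<rho> \<in> ?K"
          using \<rho>K by blast
      qed
      show "?K \<subseteq> M" "L \<subseteq> ?K"
        using less.prems(2) sub by auto
      show "regular_level (g \<tau>)" if "\<tau> \<in> ?K - L" for \<tau>
        using less.prems(4) that by blast
      show "block \<tau> \<subseteq> ?K - L" if \<tau>: "\<tau> \<in> ?K - L" for \<tau>
      proof -
        have "\<tau> \<in> M"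
          using \<tau> less.prems(2) by blast
        then have "block \<tau> \<inter> block \<sigma> = {}"
          using \<tau> block_self[of \<tau>] block_eq[of _ \<tau>] block_eq[of _ \<sigma>] by blast
        then show ?thesis
          using less.prems(5)[of \<tau>] \<tau> by blast
      qed
    qed
    then show ?thesis
      by (rule converse_rtranclp_into_rtranclp[of elementary_collapse, OF step])
  qed
qed

text \<open>
  The form used below: it suffices that \<open>K - L\<close> is a union of whole regular levels, because
  levels are unions of blocks.
\<close>

lemma induces_collapse_levels:
  assumes grad: "discrete_gradient M gradient"
    and K: "abstract_complex K" "K \<subseteq> M" and L: "abstract_complex L" "L \<subseteq> K"
    and reg: "\<And>\<sigma>. \<sigma> \<in> K - L \<Longrightarrow> regular_level (g \<sigma>)"
    and closed: "\<And>\<sigma> \<tau>. \<lbrakk>\<sigma> \<in> K - L; \<tau> \<in> M; g \<tau> = g \<sigma>\<rbrakk> \<Longrightarrow> \<tau> \<in> K - L"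
  shows "induces_collapse M gradient K L"
proof -
  have sub: "block \<sigma> \<subseteq> K - L" if "\<sigma> \<in> K - L" for \<sigma>
    using closed[OF that] by (auto simp: block_def)
  have self: "\<sigma> \<in> block \<sigma>" if "\<sigma> \<in> K - L" for \<sigma>
    using block_self that K(2) by blast
  have "block ` (K - L) \<subseteq> gradient"
    unfolding gradient_def using block_regular_interval reg K(2) by blast
  moreover have "K - L = \<Union>(block ` (K - L))"
    using sub self by blast
  ultimately have "\<exists>V\<subseteq>gradient. K - L = \<Union>V"
    by blast
  then show ?thesis
    unfolding induces_collapse_def collapses_def subcomplex_def
    using finite_M complex_M grad K L elementary_collapses_blocks[OF K L reg sub] by blast
qed

end

section \<open>Rips complexes whose simplices can be coned off\<close>

lemma diam_le_iff:
  assumes "finite S" "S \<noteq> {}"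
  shows "diam d S \<le> t \<longleftrightarrow> (\<forall>x\<in>S. \<forall>y\<in>S. d x y \<le> t)"
proof -
  have "bdd_above ((\<lambda>(x, y). d x y) ` (S \<times> S))"
    using assms(1) by (intro bdd_above_finite finite_imageI finite_cartesian_product)
  then show ?thesis
    using assms(2) unfolding diam_def by (subst cSUP_le_iff) auto
qed

lemma Rips_iff:
  assumes "finite X"
  shows "S \<in> Rips X d t \<longleftrightarrow> S \<in> Cl X \<and> (\<forall>x\<in>S. \<forall>y\<in>S. d x y \<le> t)"
  using diam_le_iff[of S d t] unfolding Rips_def Cl_def mem_Collect_eq by blast

lemma abstract_complex_Cl: "abstract_complex (Cl X)"
  by (auto simp: abstract_complex_def Cl_def intro: finite_subset)

lemma abstract_complex_Rips:
  assumes "finite X"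
  shows "abstract_complex (Rips X d t)"
  unfolding abstract_complex_def
proof (intro ballI conjI allI impI)
  fix \<sigma> assume \<sigma>: "\<sigma> \<in> Rips X d t"
  then show "finite \<sigma>" "\<sigma> \<noteq> {}"
    by (auto simp: Rips_def)
  fix \<rho> assume "\<rho> \<noteq> {} \<and> \<rho> \<subseteq> \<sigma>"
  then show "\<rho> \<in> Rips X d t"
    using \<sigma> unfolding Rips_iff[OF assms] Cl_def mem_Collect_eq
    by (meson finite_subset subset_iff subset_trans)
qed

text \<open>
  The combinatorial output of the geometry. The ranking \<open>v\<close> of the points starts with \<open>p\<close>,
  and \<open>e\<close> ranks the pairs of points compatibly with distance. The point \<open>c x\<close> is an apex for
  the simplices of diameter at most \<open>s\<close> with highest vertex \<open>x\<close>, and \<open>m (x, y)\<close> is one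
  for the simplices with highest pair \<open>(x, y)\<close>, if that pair is longer than \<open>s\<close>.
\<close>

locale apex_choice =
  fixes X :: "'a set" and d :: "'a \<Rightarrow> 'a \<Rightarrow> real" and s :: real and p :: 'a
    and v :: "'a \<Rightarrow> nat" and e :: "'a \<times> 'a \<Rightarrow> nat"
    and c :: "'a \<Rightarrow> 'a" and m :: "'a \<times> 'a \<Rightarrow> 'a"
  assumes finite_X: "finite X" and p: "p \<in> X" and s_nonneg: "0 \<le> s"
    and d_refl: "x \<in> X \<Longrightarrow> d x x = 0"
    and d_sym: "\<lbrakk>x \<in> X; y \<in> X\<rbrakk> \<Longrightarrow> d x y = d y x"
    and inj_v: "inj_on v X"
    and v_bound: "x \<in> X \<Longrightarrow> v x < card X"
    and v_p: "\<lbrakk>x \<in> X; v x \<le> v p\<rbrakk> \<Longrightarrow> x = p"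
    and inj_e: "inj_on e (X \<times> X)"
    and e_mono: "\<lbrakk>x \<in> X; y \<in> X; x' \<in> X; y' \<in> X; e (x, y) \<le> e (x', y')\<rbrakk> \<Longrightarrow> d x y \<le> d x' y'"
    and c_mem: "\<lbrakk>x \<in> X; x \<noteq> p\<rbrakk> \<Longrightarrow> c x \<in> X"
    and c_less: "\<lbrakk>x \<in> X; x \<noteq> p\<rbrakk> \<Longrightarrow> v (c x) < v x"
    and c_close: "\<lbrakk>x \<in> X; x \<noteq> p; w \<in> X; v w \<le> v x; d w x \<le> s\<rbrakk> \<Longrightarrow> d w (c x) \<le> s"
    and m_mem: "\<lbrakk>x \<in> X; y \<in> X; s < d x y\<rbrakk> \<Longrightarrow> m (x, y) \<in> X"
    and m_close: "\<lbrakk>x \<in> X; y \<in> X; s < d x y; w \<in> X; d w x \<le> d x y; d w y \<le> d x y\<rbrakk>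
                    \<Longrightarrow> d w (m (x, y)) < d x y"
begin

definition short :: "'a set \<Rightarrow> bool" where
  "short \<sigma> \<longleftrightarrow> (\<forall>x\<in>\<sigma>. \<forall>y\<in>\<sigma>. d x y \<le> s)"

text \<open>
  The offset \<open>card X\<close> places all long simplices above the short ones, and makes the highest
  vertex or pair recoverable from the level; \<open>level_apex\<close> relies on this.
\<close>

definition level :: "'a set \<Rightarrow> nat" where
  "level \<sigma> = (if short \<sigma> then Max (v ` \<sigma>) else card X + Max (e ` (\<sigma> \<times> \<sigma>)))"

definition level_apex :: "nat \<Rightarrow> 'a" where
  "level_apex n = (if n < card X then c (inv_into X v n) else m (inv_into (X \<times> X) e (n - card X)))"

lemma ClD: "\<sigma> \<in> Cl X \<Longrightarrow> \<sigma> \<subseteq> X \<and> finite \<sigma> \<and> \<sigma> \<noteq> {}"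
  by (auto simp: Cl_def)

text \<open>
  The next four lemmas translate between the maximum in the definition of the level and the vertex
  or pair that attains it.
\<close>

lemma level_short:
  assumes "\<sigma> \<in> Cl X" "short \<sigma>"
  obtains x where "x \<in> \<sigma>" "level \<sigma> = v x" "\<And>w. w \<in> \<sigma> \<Longrightarrow> v w \<le> v x"
    "level_apex (level \<sigma>) = c x" "level \<sigma> < card X"
proof -
  have \<sigma>: "\<sigma> \<subseteq> X" "finite \<sigma>" "\<sigma> \<noteq> {}"
    using ClD[OF assms(1)] by auto
  have "Max (v ` \<sigma>) \<in> v ` \<sigma>"
    using \<sigma> by (intro Max_in) auto
  then obtain x where x: "x \<in> \<sigma>" "Max (v ` \<sigma>) = v x"
    by auto
  show ?thesis
  proof (rule that[of x])
    show lv: "level \<sigma> = v x"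
      using x assms(2) by (simp add: level_def)
    show "v w \<le> v x" if "w \<in> \<sigma>" for w
      using x(2)[symmetric] \<sigma>(2) that by simp
    show "level_apex (level \<sigma>) = c x" "level \<sigma> < card X"
      using lv x(1) \<sigma>(1) v_bound inv_into_f_f[OF inj_v] by (auto simp: level_apex_def)
  qed (use x in simp)
qed

lemma level_long:
  assumes "\<sigma> \<in> Cl X" "\<not> short \<sigma>"
  obtains x y where "x \<in> \<sigma>" "y \<in> \<sigma>" "level \<sigma> = card X + e (x, y)"
    "\<And>a b. \<lbrakk>a \<in> \<sigma>; b \<in> \<sigma>\<rbrakk> \<Longrightarrow> e (a, b) \<le> e (x, y)"
    "\<And>a b. \<lbrakk>a \<in> \<sigma>; b \<in> \<sigma>\<rbrakk> \<Longrightarrow> d a b \<le> d x y" "s < d x y"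
    "level_apex (level \<sigma>) = m (x, y)"
proof -
  have \<sigma>: "\<sigma> \<subseteq> X" "finite \<sigma>" "\<sigma> \<noteq> {}"
    using ClD[OF assms(1)] by auto
  have "Max (e ` (\<sigma> \<times> \<sigma>)) \<in> e ` (\<sigma> \<times> \<sigma>)"
    using \<sigma> by (intro Max_in) auto
  then obtain x y where x: "x \<in> \<sigma>" "y \<in> \<sigma>" "Max (e ` (\<sigma> \<times> \<sigma>)) = e (x, y)"
    by auto
  show ?thesis
  proof (rule that[of x y])
    show lv: "level \<sigma> = card X + e (x, y)"
      using x assms(2) by (simp add: level_def)
    show e: "e (a, b) \<le> e (x, y)" if "a \<in> \<sigma>" "b \<in> \<sigma>" for a b
      unfolding x(3)[symmetric] using \<sigma>(2) that by (intro Max_ge) auto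
    show dd: "d a b \<le> d x y" if "a \<in> \<sigma>" "b \<in> \<sigma>" for a b
      using e_mono[of a b x y] e[OF that] that x(1,2) \<sigma>(1) by auto
    obtain a b where "a \<in> \<sigma>" "b \<in> \<sigma>" "s < d a b"
      using assms(2) by (auto simp: short_def not_le)
    then show "s < d x y"
      using dd[of a b] by linarith
    show "level_apex (level \<sigma>) = m (x, y)"
      using lv subsetD[OF \<sigma>(1) x(1)] subsetD[OF \<sigma>(1) x(2)] inv_into_f_f[OF inj_e, of "(x, y)"]
      by (simp add: level_apex_def)
  qed (use x in simp_all)
qed

lemma levelI_short:
  assumes "\<sigma> \<in> Cl X" "short \<sigma>" "x \<in> \<sigma>" "\<And>w. w \<in> \<sigma> \<Longrightarrow> v w \<le> v x"
  shows "level \<sigma> = v x"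
proof -
  have "Max (v ` \<sigma>) = v x"
    using assms ClD[OF assms(1)] by (intro Max_eqI) auto
  then show ?thesis
    using assms(2) by (simp add: level_def)
qed

lemma levelI_long:
  assumes "\<sigma> \<in> Cl X" "s < d x y" "x \<in> \<sigma>" "y \<in> \<sigma>"
    "\<And>a b. \<lbrakk>a \<in> \<sigma>; b \<in> \<sigma>\<rbrakk> \<Longrightarrow> e (a, b) \<le> e (x, y)"
  shows "level \<sigma> = card X + e (x, y)"
proof -
  have "Max (e ` (\<sigma> \<times> \<sigma>)) = e (x, y)"
    using assms ClD[OF assms(1)] by (intro Max_eqI) auto
  moreover have "\<not> short \<sigma>"
    using assms(2-4) by (force simp: short_def)
  ultimately show ?thesis
    by (simp add: level_def)
qed

lemma level_mono:
  assumes "\<sigma> \<in> Cl X" "\<tau> \<in> Cl X" "\<sigma> \<subseteq> \<tau>"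
  shows "level \<sigma> \<le> level \<tau>"
proof (cases "short \<tau>")
  case True
  then have "short \<sigma>"
    using assms(3) by (auto simp: short_def)
  then show ?thesis
    using True assms ClD[OF assms(1)] ClD[OF assms(2)]
    by (auto simp: level_def intro!: Max_mono)
next
  case False
  show ?thesis
  proof (cases "short \<sigma>")
    case True
    then have "level \<sigma> < card X"
      using level_short[OF assms(1)] by metis
    then show ?thesis
      using False by (simp add: level_def)
  next
    case long: False
    have "Max (e ` (\<sigma> \<times> \<sigma>)) \<le> Max (e ` (\<tau> \<times> \<tau>))"
      using assms ClD[OF assms(1)] ClD[OF assms(2)] by (intro Max_mono) auto
    then show ?thesis
      using False long by (simp add: level_def)
  qed
qed

lemma finite_Cl: "finite (Cl X)"
  by (rule finite_subset[of _ "Pow X"]) (use finite_X in \<open>auto simp: Cl_def\<close>)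

sublocale level_cones "Cl X" level level_apex
  by unfold_locales (use finite_Cl abstract_complex_Cl level_mono in auto)

text \<open>
  The apex \<open>c x\<close> ranks strictly below \<open>x\<close>, so \<open>x\<close> remains the highest vertex whether
  \<open>c x\<close> is inserted or deleted.
\<close>

lemma regular_level_short:
  assumes "x \<in> X" "x \<noteq> p"
  shows "regular_level (v x)"
  unfolding regular_level_def
proof (intro ballI impI)
  fix \<sigma> assume \<sigma>: "\<sigma> \<in> Cl X" "level \<sigma> = v x"
  let ?z = "level_apex (v x)"
  have short: "short \<sigma>"
    using v_bound[OF assms(1)] \<sigma>(2) by (auto simp: level_def split: if_splits)
  obtain y where y: "y \<in> \<sigma>" "level \<sigma> = v y" "\<And>w. w \<in> \<sigma> \<Longrightarrow> v w \<le> v y"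
    "level_apex (level \<sigma>) = c y"
    using level_short[OF \<sigma>(1) short] by blast
  have sub: "\<sigma> \<subseteq> X" and fin: "finite \<sigma>"
    using ClD[OF \<sigma>(1)] by auto
  have "y = x"
    using inj_onD[OF inj_v] y(1,2) \<sigma>(2) sub assms(1) by auto
  then have x: "x \<in> \<sigma>" "\<And>w. w \<in> \<sigma> \<Longrightarrow> v w \<le> v x" and z: "?z = c x"
    using y \<sigma>(2) by auto
  have cX: "c x \<in> X" and cx: "v (c x) < v x"
    using c_mem c_less assms by auto
  have close: "d w (c x) \<le> s" if "w \<in> \<sigma>" for w
    using c_close[OF assms, of w] that x(1) x(2)[OF that] sub short by (auto simp: short_def)
  have "short (insert (c x) \<sigma>)"
    unfolding short_def
  proof (intro ballI)
    fix a b assume "a \<in> insert (c x) \<sigma>" "b \<in> insert (c x) \<sigma>"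
    then consider "a \<in> \<sigma>" "b \<in> \<sigma>" | "a \<in> \<sigma>" "b = c x" | "a = c x" "b \<in> \<sigma>" | "a = c x" "b = c x"
      by blast
    then show "d a b \<le> s"
    proof cases
      case 1
      then show ?thesis
        using short by (simp add: short_def)
    next
      case 2
      then show ?thesis
        using close by simp
    next
      case 3
      then show ?thesis
        using close[of b] d_sym[OF cX, of b] sub by auto
    next
      case 4
      then show ?thesis
        using d_refl[OF cX] s_nonneg by simp
    qed
  qed
  moreover have ins: "insert (c x) \<sigma> \<in> Cl X"
    using \<sigma>(1) cX by (auto simp: Cl_def)
  ultimately have "level (insert (c x) \<sigma>) = v x"
    using x cx by (intro levelI_short) auto
  moreover have "x \<in> \<sigma> - {c x}"
    using x cx by auto
  moreover from this have del: "\<sigma> - {c x} \<in> Cl X"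
    using sub fin by (auto simp: Cl_def)
  moreover have "level (\<sigma> - {c x}) = v x"
    using del \<open>x \<in> \<sigma> - {c x}\<close> x short by (intro levelI_short) (auto simp: short_def)
  ultimately show "insert ?z \<sigma> \<in> Cl X \<and> level (insert ?z \<sigma>) = v x \<and>
      \<sigma> - {?z} \<in> Cl X \<and> level (\<sigma> - {?z}) = v x"
    using ins z by simp
qed

text \<open>
  All edges at the apex \<open>m (x, y)\<close> are strictly shorter than \<open>d x y\<close>. So no tie can promote one
  of them above \<open>(x, y)\<close>, and the apex is not an end point of the highest pair.
\<close>

lemma regular_level_long: "regular_level (card X + k)"
  unfolding regular_level_def
proof (intro ballI impI)
  fix \<sigma> assume \<sigma>: "\<sigma> \<in> Cl X" "level \<sigma> = card X + k"
  let ?z = "level_apex (card X + k)"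
  have long: "\<not> short \<sigma>"
    using level_short[OF \<sigma>(1)] \<sigma>(2) by (metis not_add_less1)
  obtain x y where x: "x \<in> \<sigma>" "y \<in> \<sigma>" and lv: "level \<sigma> = card X + e (x, y)"
    and e: "\<And>a b. \<lbrakk>a \<in> \<sigma>; b \<in> \<sigma>\<rbrakk> \<Longrightarrow> e (a, b) \<le> e (x, y)"
    and dd: "\<And>a b. \<lbrakk>a \<in> \<sigma>; b \<in> \<sigma>\<rbrakk> \<Longrightarrow> d a b \<le> d x y" and s: "s < d x y"
    and z: "?z = m (x, y)"
    using level_long[OF \<sigma>(1) long] unfolding \<sigma>(2) by blast
  have sub: "\<sigma> \<subseteq> X" and fin: "finite \<sigma>"
    using ClD[OF \<sigma>(1)] by auto
  have xX: "x \<in> X" "y \<in> X"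
    using x sub by auto
  have zX: "m (x, y) \<in> X"
    using m_mem[OF xX s] .
  have close: "d w (m (x, y)) < d x y" if "w \<in> \<sigma>" for w
    using m_close[OF xX s, of w] that sub dd[OF that x(1)] dd[OF that x(2)] by auto
  have ins: "insert (m (x, y)) \<sigma> \<in> Cl X"
    using \<sigma>(1) zX by (auto simp: Cl_def)
  have "e (a, b) \<le> e (x, y)" if "a \<in> insert (m (x, y)) \<sigma>" "b \<in> insert (m (x, y)) \<sigma>" for a b
  proof (cases "a \<in> \<sigma> \<and> b \<in> \<sigma>")
    case True
    then show ?thesis
      using e by blast
  next
    case False
    have ab: "a \<in> X" "b \<in> X"
      using that sub zX by auto
    consider "a \<in> \<sigma>" "b = m (x, y)" | "a = m (x, y)" "b \<in> \<sigma>" | "a = m (x, y)" "b = m (x, y)"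
      using \<open>a \<in> insert (m (x, y)) \<sigma>\<close> \<open>b \<in> insert (m (x, y)) \<sigma>\<close> False by blast
    then have "d a b < d x y"
    proof cases
      case 1
      then show ?thesis
        using close by simp
    next
      case 2
      then show ?thesis
        using close[of b] d_sym[OF ab] by simp
    next
      case 3
      then show ?thesis
        using d_refl[OF zX] s s_nonneg by simp
    qed
    then show ?thesis
      using e_mono[OF xX ab] by linarith
  qed
  then have lins: "level (insert (m (x, y)) \<sigma>) = card X + e (x, y)"
    using ins s x by (intro levelI_long) auto
  have "m (x, y) \<noteq> x" "m (x, y) \<noteq> y"
    using close[OF x(1)] close[OF x(2)] d_sym[OF xX] by auto
  then have x': "x \<in> \<sigma> - {m (x, y)}" "y \<in> \<sigma> - {m (x, y)}"
    using x by auto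
  then have del: "\<sigma> - {m (x, y)} \<in> Cl X"
    using sub fin by (auto simp: Cl_def)
  have "level (\<sigma> - {m (x, y)}) = card X + e (x, y)"
    using del x' s e by (intro levelI_long) auto
  then show "insert ?z \<sigma> \<in> Cl X \<and> level (insert ?z \<sigma>) = card X + k \<and>
      \<sigma> - {?z} \<in> Cl X \<and> level (\<sigma> - {?z}) = card X + k"
    using ins del lins z lv \<sigma>(2) by simp
qed

lemma level_p:
  assumes "\<sigma> \<in> Cl X"
  shows "level \<sigma> = level {p} \<longleftrightarrow> \<sigma> = {p}"
proof
  assume eq: "level \<sigma> = level {p}"
  have "{p} \<in> Cl X" "short {p}"
    using p d_refl s_nonneg by (auto simp: Cl_def short_def)
  then have lp: "level {p} = v p"
    by (intro levelI_short) auto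
  then have short: "short \<sigma>"
    using eq v_bound[OF p] by (auto simp: level_def split: if_splits)
  have "w = p" if "w \<in> \<sigma>" for w
    using level_short[OF assms short] v_p eq lp ClD[OF assms] that by (metis subsetD)
  then show "\<sigma> = {p}"
    using ClD[OF assms] by blast
qed simp

lemma regular_level_noncritical:
  assumes "\<sigma> \<in> Cl X" "\<sigma> \<noteq> {p}"
  shows "regular_level (level \<sigma>)"
proof (cases "short \<sigma>")
  case True
  obtain x where x: "x \<in> \<sigma>" "level \<sigma> = v x" "\<And>w. w \<in> \<sigma> \<Longrightarrow> v w \<le> v x"
    using level_short[OF assms(1) True] by metis
  have "x \<noteq> p"
    using x(3) v_p ClD[OF assms(1)] assms(2) by blast
  then show ?thesis
    using regular_level_short x(1,2) ClD[OF assms(1)] by auto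
next
  case False
  then show ?thesis
    using regular_level_long by (simp add: level_def)
qed

text \<open>
  The matching respects the Rips filtration above \<open>s\<close>: the level of a long simplex determines
  its highest pair and thereby its diameter.
\<close>

lemma Rips_level:
  assumes "s \<le> t" "\<sigma> \<in> Rips X d t" "\<tau> \<in> Cl X" "level \<tau> = level \<sigma>"
  shows "\<tau> \<in> Rips X d t"
proof (cases "short \<tau>")
  case True
  then show ?thesis
    using assms(1,3) by (fastforce simp: Rips_iff[OF finite_X] short_def)
next
  case False
  have \<sigma>: "\<sigma> \<in> Cl X" and \<sigma>t: "\<forall>x\<in>\<sigma>. \<forall>y\<in>\<sigma>. d x y \<le> t"
    using assms(2) by (auto simp: Rips_iff[OF finite_X])
  obtain x y where x: "x \<in> \<tau>" "y \<in> \<tau>" "level \<tau> = card X + e (x, y)"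
    "\<And>a b. \<lbrakk>a \<in> \<tau>; b \<in> \<tau>\<rbrakk> \<Longrightarrow> d a b \<le> d x y"
    using level_long[OF assms(3) False] by metis
  have "\<not> short \<sigma>"
    using level_short[OF \<sigma>] x(3) assms(4) by (metis not_add_less1)
  then obtain x' y' where x': "x' \<in> \<sigma>" "y' \<in> \<sigma>" "level \<sigma> = card X + e (x', y')"
    using level_long[OF \<sigma>] by metis
  have "(x, y) = (x', y')"
    using inj_onD[OF inj_e, of "(x, y)" "(x', y')"] x(1-3) x' assms(4) ClD[OF \<sigma>] ClD[OF assms(3)]
    by auto
  then have "d x y \<le> t"
    using \<sigma>t x' by auto
  then show ?thesis
    using x(4) assms(3) by (fastforce simp: Rips_iff[OF finite_X])
qed

lemma discrete_gradient_apex: "discrete_gradient (Cl X) gradient"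
proof (rule discrete_gradient_gradient)
  fix \<sigma> assume "\<sigma> \<in> Cl X"
  then show "regular_level (level \<sigma>) \<or> (\<forall>\<tau>\<in>Cl X. level \<tau> = level \<sigma> \<longrightarrow> \<tau> = \<sigma>)"
    using regular_level_noncritical level_p by (cases "\<sigma> = {p}") auto
qed

lemma p_Rips: "s \<le> t \<Longrightarrow> {p} \<in> Rips X d t"
  using p d_refl s_nonneg by (auto simp: Rips_iff[OF finite_X] Cl_def)

lemma induces_collapse_Rips:
  assumes "s \<le> t" "t < u"
  shows "induces_collapse (Cl X) gradient (Rips X d u) (Rips X d t)"
proof (rule induces_collapse_levels[OF discrete_gradient_apex])
  show "Rips X d u \<subseteq> Cl X" "Rips X d t \<subseteq> Rips X d u"
    using assms by (fastforce simp: Rips_iff[OF finite_X])+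
  show "regular_level (level \<sigma>)" if "\<sigma> \<in> Rips X d u - Rips X d t" for \<sigma>
    using that p_Rips[OF assms(1)] regular_level_noncritical by (auto simp: Rips_iff[OF finite_X])
  show "\<tau> \<in> Rips X d u - Rips X d t"
    if "\<sigma> \<in> Rips X d u - Rips X d t" "\<tau> \<in> Cl X" "level \<tau> = level \<sigma>" for \<sigma> \<tau>
  proof -
    have "\<sigma> \<in> Cl X"
      using that(1) by (auto simp: Rips_iff[OF finite_X])
    then show ?thesis
      using that Rips_level[of u \<sigma> \<tau>] Rips_level[of t \<tau> \<sigma>] assms by auto
  qed
qed (use abstract_complex_Rips finite_X in auto)

lemma induces_collapse_point:
  assumes "s \<le> t"
  shows "induces_collapse (Cl X) gradient (Rips X d t) {{p}}"
proof (rule induces_collapse_levels[OF discrete_gradient_apex])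
  show "Rips X d t \<subseteq> Cl X" "{{p}} \<subseteq> Rips X d t"
    using p_Rips[OF assms] by (auto simp: Rips_iff[OF finite_X])
  show "regular_level (level \<sigma>)" if "\<sigma> \<in> Rips X d t - {{p}}" for \<sigma>
    using that regular_level_noncritical by (auto simp: Rips_iff[OF finite_X])
  show "\<tau> \<in> Rips X d t - {{p}}"
    if "\<sigma> \<in> Rips X d t - {{p}}" "\<tau> \<in> Cl X" "level \<tau> = level \<sigma>" for \<sigma> \<tau>
  proof -
    have "\<sigma> \<in> Cl X"
      using that(1) by (auto simp: Rips_iff[OF finite_X])
    then show ?thesis
      using that Rips_level[of t \<sigma> \<tau>] level_p[of \<sigma>] assms by auto
  qed
  show "abstract_complex {{p}}"
    by (auto simp: abstract_complex_def subset_singleton_iff)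
qed (use abstract_complex_Rips finite_X in auto)

end

section \<open>Apexes in hyperbolic spaces with small geodesic defect\<close>

text \<open>
  Hyperbolicity for \<open>w, z, x, y\<close> bounds \<open>d w z + d x y\<close> by
  \<open>d x y + (d x y / 2 + \<nu>) + 2 * \<delta>\<close>. The lower bound on \<open>d x y\<close> is exactly what makes the
  resulting bound on \<open>d w z\<close> smaller than \<open>d x y\<close>.
\<close>

lemma midpoint_apex:
  fixes d :: "'a \<Rightarrow> 'a \<Rightarrow> real"
  assumes "Metric_space X d" "gromov_hyperbolic \<delta> X d" "nu_geodesic \<nu> X d"
    and xy: "x \<in> X" "y \<in> X" "4 * \<delta> + 2 * \<nu> < d x y"
  obtains z where "z \<in> X"
    "\<And>w. \<lbrakk>w \<in> X; d w x \<le> d x y; d w y \<le> d x y\<rbrakk> \<Longrightarrow> d w z < d x y"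
proof -
  interpret Metric_space X d by fact
  have "0 \<le> d x y / 2"
    by simp
  then obtain z where z: "z \<in> X" "d x z \<le> d x y / 2 + \<nu>" "d y z \<le> d x y / 2 + \<nu>"
    using assms(3) xy unfolding nu_geodesic_def by (metis field_sum_of_halves)
  have "d w z < d x y" if w: "w \<in> X" "d w x \<le> d x y" "d w y \<le> d x y" for w
  proof -
    have "d w z + d x y \<le> max (d w x + d z y) (d w y + d z x) + 2 * \<delta>"
      using assms(2) w(1) z(1) xy(1,2) commute unfolding gromov_hyperbolic_def by metis
    then show ?thesis
      using w z xy(3) commute[of z] by (simp add: max_def split: if_splits)
  qed
  then show ?thesis
    using that z(1) by blast
qed

text \<open>
  If \<open>x\<close> is within \<open>s = 4 * \<delta> + 2 * \<nu>\<close> of \<open>p\<close>, the apex is \<open>p\<close> itself.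
  Otherwise step from \<open>x\<close> towards \<open>p\<close>. A step of length \<open>s / 2\<close> would give the bound
  \<open>d w z \<le> s\<close> directly, but only \<open>d p z \<le> d p x - 2 * \<delta>\<close>, which is not a strict
  decrease when \<open>\<delta> = 0\<close>. A slightly longer step of length \<open>s / 2 + \<epsilon>\<close> makes the decrease
  strict and weakens the other bound to \<open>s + \<epsilon>\<close>; since only finitely many distances occur,
  a small \<open>\<epsilon>\<close> costs nothing.
\<close>

lemma apex_towards_basepoint:
  fixes d :: "'a \<Rightarrow> 'a \<Rightarrow> real"
  assumes "Metric_space X d" "finite X" "gromov_hyperbolic \<delta> X d" "nu_geodesic \<nu> X d"
    and defect_nonneg: "0 \<le> \<delta>" "0 \<le> \<nu>"
    and xp: "x \<in> X" "p \<in> X" "x \<noteq> p"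
  obtains z where "z \<in> X" "d p z < d p x"
    "\<And>w. \<lbrakk>w \<in> X; d p w \<le> d p x; d w x \<le> 4 * \<delta> + 2 * \<nu>\<rbrakk> \<Longrightarrow> d w z \<le> 4 * \<delta> + 2 * \<nu>"
proof -
  interpret Metric_space X d by fact
  define s where "s = 4 * \<delta> + 2 * \<nu>"
  show ?thesis
  proof (cases "d p x \<le> s")
    case True
    have "d w p \<le> s" if "d p w \<le> d p x" for w
      using that True commute[of w p] by linarith
    then show ?thesis
      using that[of p] xp mdist_pos_less[of p x] by (simp add: s_def)
  next
    case False
    define D where "D = insert (d p x) {r. r \<in> (\<lambda>(a, b). d a b) ` (X \<times> X) \<and> s < r}"
    have D: "finite D" "D \<noteq> {}"
      using assms(2) by (auto simp: D_def)
    \<comment> \<open>half the gap between \<open>s\<close> and the next larger distance\<close>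
    define \<epsilon> where "\<epsilon> = (Min D - s) / 2"
    have "s < Min D"
      using D False by (auto simp: D_def)
    then have \<epsilon>: "0 < \<epsilon>"
      by (simp add: \<epsilon>_def)
    have gap: "r \<le> s" if "r \<in> (\<lambda>(a, b). d a b) ` (X \<times> X)" "r \<le> s + \<epsilon>" for r
    proof (rule ccontr)
      assume "\<not> r \<le> s"
      then have "Min D \<le> r"
        using that(1) D by (intro Min_le) (auto simp: D_def)
      then show False
        using that(2) \<epsilon> by (simp add: \<epsilon>_def field_simps)
    qed
    have le: "s + 2 * \<epsilon> \<le> d p x"
    proof -
      have "d p x \<in> D"
        by (simp add: D_def)
      then have "Min D \<le> d p x"
        by (rule Min_le[OF D(1)])
      then show ?thesis
        by (simp add: \<epsilon>_def field_simps)
    qed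
    have s: "0 \<le> s"
      unfolding s_def using defect_nonneg by linarith
    define r where "r = 2 * \<delta> + \<nu> + \<epsilon>"
    have "0 \<le> r" "0 \<le> d p x - r"
      using le \<epsilon> s defect_nonneg unfolding r_def s_def by linarith+
    moreover have "r + (d p x - r) = d x p"
      by (simp add: commute)
    ultimately obtain z where z: "z \<in> X" "d x z \<le> r + \<nu>" "d p z \<le> d p x - r + \<nu>"
      using assms(4) xp(1,2) unfolding nu_geodesic_def by metis
    have less: "d p z < d p x"
      using z(3) \<epsilon> defect_nonneg unfolding r_def by linarith
    have "d w z \<le> s" if w: "w \<in> X" "d p w \<le> d p x" "d w x \<le> s" for w
    proof -
      have "d w z + d x p \<le> max (d w x + d z p) (d w p + d z x) + 2 * \<delta>"
        using assms(3) w(1) z(1) xp(1,2) commute unfolding gromov_hyperbolic_def by metis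
      then have "d w z \<le> s + \<epsilon>"
        using w(2,3) z(2,3) \<epsilon> commute[of z p] commute[of z x] commute[of x p] commute[of w p]
        unfolding r_def s_def max_def by (simp split: if_splits)
      then show ?thesis
        using gap w(1) z(1) by auto
    qed
    then show ?thesis
      using that z(1) less by (simp add: s_def)
  qed
qed

lemma ex_ranking:
  fixes f :: "'b \<Rightarrow> real"
  assumes "finite A"
  obtains r :: "'b \<Rightarrow> nat" where "inj_on r A" "\<And>a. a \<in> A \<Longrightarrow> r a < card A"
    "\<And>a b. \<lbrakk>a \<in> A; b \<in> A; r a \<le> r b\<rbrakk> \<Longrightarrow> f a \<le> f b"
proof -
  have "\<exists>r :: 'b \<Rightarrow> nat. inj_on r A \<and> (\<forall>a\<in>A. r a < card A) \<and>
      (\<forall>a\<in>A. \<forall>b\<in>A. r a \<le> r b \<longrightarrow> f a \<le> f b)"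
    using assms
  proof (induction A rule: finite_ranking_induct[where f = f])
    case empty
    then show ?case by simp
  next
    case (insert x S)
    show ?case
    proof (cases "x \<in> S")
      case True
      then show ?thesis
        using insert.IH by (simp add: insert_absorb)
    next
      case False
      obtain r :: "'b \<Rightarrow> nat" where r: "inj_on r S" "\<forall>a\<in>S. r a < card S"
        "\<forall>a\<in>S. \<forall>b\<in>S. r a \<le> r b \<longrightarrow> f a \<le> f b"
        using insert.IH by blast
      have ne: "a \<noteq> x" if "a \<in> S" for a
        using that False by blast
      let ?r = "r(x := card S)"
      have "inj_on ?r (insert x S)"
        using r(1,2) ne by (fastforce simp: inj_on_def)
      moreover have "\<forall>a\<in>insert x S. ?r a < card (insert x S)"
        using r(2) ne False insert.hyps(1) by (auto simp: less_SucI)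
      moreover have "\<forall>a\<in>insert x S. \<forall>b\<in>insert x S. ?r a \<le> ?r b \<longrightarrow> f a \<le> f b"
        using r(2,3) ne insert.hyps(2) by (fastforce simp: linorder_not_less)
      ultimately show ?thesis by blast
    qed
  qed
  then show ?thesis
    using that by blast
qed

theorem theorem3:
  fixes X :: "'a set" and d :: "'a \<Rightarrow> 'a \<Rightarrow> real" and \<delta> \<nu> :: real
  assumes "Metric_space X d" and "finite X" and "X \<noteq> {}"
    and "\<delta> \<ge> 0" and "\<nu> \<ge> 0"
    and "gromov_hyperbolic \<delta> X d" and "nu_geodesic \<nu> X d"
  shows "\<exists>W. discrete_gradient (Cl X) W \<and>
           (\<exists>v\<in>X. \<forall>u t. u > t \<and> t \<ge> 4 * \<delta> + 2 * \<nu> \<longrightarrow>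
              induces_collapse (Cl X) W (Rips X d u) (Rips X d t) \<and>
              induces_collapse (Cl X) W (Rips X d t) {{v}})"
proof -
  interpret Metric_space X d by fact
  define s where "s = 4 * \<delta> + 2 * \<nu>"
  obtain p where p: "p \<in> X"
    using assms(3) by blast
  obtain v where v: "inj_on v X" "\<And>a. a \<in> X \<Longrightarrow> v a < card X"
    "\<And>a b. \<lbrakk>a \<in> X; b \<in> X; v a \<le> v b\<rbrakk> \<Longrightarrow> d p a \<le> d p b"
    using ex_ranking[OF assms(2), of "d p"] by metis
  have "finite (X \<times> X)"
    using assms(2) by simp
  then obtain e :: "'a \<times> 'a \<Rightarrow> nat" where e: "inj_on e (X \<times> X)"
    "\<And>a b. \<lbrakk>a \<in> X \<times> X; b \<in> X \<times> X; e a \<le> e b\<rbrakk> \<Longrightarrow> case_prod d a \<le> case_prod d b"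
    by (rule ex_ranking[where f = "case_prod d"]) blast
  have "\<exists>z. x \<in> X \<longrightarrow> x \<noteq> p \<longrightarrow> z \<in> X \<and> d p z < d p x \<and>
      (\<forall>w\<in>X. d p w \<le> d p x \<longrightarrow> d w x \<le> s \<longrightarrow> d w z \<le> s)" for x
    using apex_towards_basepoint[OF assms(1,2,6,7,4,5) _ p, of x] unfolding s_def by metis
  then obtain c where c: "\<And>x. \<lbrakk>x \<in> X; x \<noteq> p\<rbrakk> \<Longrightarrow> c x \<in> X \<and> d p (c x) < d p x \<and>
      (\<forall>w\<in>X. d p w \<le> d p x \<longrightarrow> d w x \<le> s \<longrightarrow> d w (c x) \<le> s)"
    by metis
  have "\<exists>z. x \<in> X \<longrightarrow> y \<in> X \<longrightarrow> s < d x y \<longrightarrow> z \<in> X \<and>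
      (\<forall>w\<in>X. d w x \<le> d x y \<longrightarrow> d w y \<le> d x y \<longrightarrow> d w z < d x y)" for x y
    using midpoint_apex[OF assms(1,6,7), of x y] unfolding s_def by metis
  then obtain m where m: "\<And>x y. \<lbrakk>x \<in> X; y \<in> X; s < d x y\<rbrakk> \<Longrightarrow> m x y \<in> X \<and>
      (\<forall>w\<in>X. d w x \<le> d x y \<longrightarrow> d w y \<le> d x y \<longrightarrow> d w (m x y) < d x y)"
    by metis
  interpret apex_choice X d s p v e c "\<lambda>(x, y). m x y"
  proof unfold_locales
    show "0 \<le> s"
      using assms(4,5) by (simp add: s_def)
    show "x = p" if x: "x \<in> X" "v x \<le> v p" for x
    proof (rule ccontr)
      assume "x \<noteq> p"
      then have "0 < d p x"
        using mdist_pos_less[of p x] x(1) p by auto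
      moreover have "d p x \<le> 0"
        using v(3)[OF x(1) p x(2)] p by simp
      ultimately show False
        by linarith
    qed
    show "v (c x) < v x" if "x \<in> X" "x \<noteq> p" for x
      using c[OF that] v(3)[of x "c x"] that by (meson linorder_not_less)
    show "d w (c x) \<le> s" if "x \<in> X" "x \<noteq> p" "w \<in> X" "v w \<le> v x" "d w x \<le> s" for x w
      using c[OF that(1,2)] v(3) that by blast
    show "d x y \<le> d x' y'" if "x \<in> X" "y \<in> X" "x' \<in> X" "y' \<in> X" "e (x, y) \<le> e (x', y')" for x y x' y'
      using e(2)[of "(x, y)" "(x', y')"] that by simp
  qed (use assms(2) p v e c m commute in auto)
  show ?thesis
    using discrete_gradient_apex induces_collapse_Rips induces_collapse_point p
    unfolding s_def by blast
qed

end
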